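(* Let $\mathcal{G}$ be a family of graphs, each of order at least $2$, and put $\delta(\mathcal{G})=\min\{\delta(G): G\in\mathcal{G}\}$, assumed to be at least $1$. Let $H$ be a graph with $n(H)$ vertices and let $\overline{H}$ be its complement. Then \[ \chi_{\mathcal{G}}(H)+\chi_{\mathcal{G}}(\overline{H})\leq \begin{cases} \left\lceil \frac{n(H)}{\delta(\mathcal{G})}\right\rceil+1 & \text{if } \mathcal{G}=\mathcal{C}, \text{ or if } H \text{ or } \overline{H} \text{ is } \mathcal{G}\text{-free critical},\\[2mm] \left\lceil \frac{n(H)}{\delta(\mathcal{G})}\right\rceil+2 & \text{otherwise.} \end{cases} \]
   Context: All graphs are finite, simple and undirected. A copy of a graph $G$ in a graph $H$ is a subgraph of $H$ isomorphic to $G$. For a family $\mathcal{G}$ of graphs, a $\mathcal{G}$-free $k$-coloring of $H$ is a map $\pi:V(H)\to\{1,\dots,k\}$ such that for each $i$, the induced subgraph $H[\pi^{-1}(i)]$ contains no copy of any member of $\mathcal{G}$. The $\mathcal{G}$-free chromatic number $\chi_{\mathcal{G}}(H)$ is the least $k$ for which $H$ has a $\mathcal{G}$-free $k$-coloring. A graph $H$ with $\chi_{\mathcal{G}}(H)=k$ is $\mathcal{G}$-free critical ($\mathcal{G}$-free $k$-critical) if every proper subgraph $H'$ of $H$ satisfies $\chi_{\mathcal{G}}(H')\leq k-1$. $\mathcal{C}$ denotes the family of all $2$-regular graphs. $\delta(\cdot)$ denotes minimum degree and $\overline{H}$ the complement of $H$. *)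

theory Defs
  imports "Graph_Theory.Graph_Theory"
begin

text \<open>
  A finite simple undirected graph is a finite symmetric loop-free digraph without parallel arcs
  (\<^locale>\<open>graph\<close>, \<^locale>\<open>pair_graph\<close>): each edge is represented by its two arcs.
  In particular the degree of a vertex is its \<^const>\<open>out_degree\<close>, a subgraph is a \<^const>\<open>subgraph\<close>
  that is itself a \<^locale>\<open>graph\<close> (i.e. symmetric), and a graph isomorphism is a \<^const>\<open>digraph_iso\<close>.

  Every finite graph is isomorphic to one with vertices in \<^typ>\<open>nat\<close>, so a family of graphs
  is a set of graphs over \<^typ>\<open>nat\<close>; it may be infinite.
\<close>

type_synonym graph_family = "nat pair_pre_digraph set"

definition contains_copy :: "('a, 'b) pre_digraph \<Rightarrow> ('c, 'd) pre_digraph \<Rightarrow> bool" where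
  "contains_copy H G \<longleftrightarrow> (\<exists>S. subgraph S H \<and> graph S \<and> digraph_iso G S)"

definition free_coloring ::
  "graph_family \<Rightarrow> ('a, 'b) pre_digraph \<Rightarrow> nat \<Rightarrow> ('a \<Rightarrow> nat) \<Rightarrow> bool" where
  "free_coloring \<G> H k \<pi> \<longleftrightarrow>
     (\<forall>v \<in> verts H. \<pi> v \<in> {1..k}) \<and>
     (\<forall>i \<in> {1..k}. \<forall>G \<in> \<G>. \<not> contains_copy (H \<restriction> {v \<in> verts H. \<pi> v = i}) (with_proj G))"

definition free_chromatic_number :: "graph_family \<Rightarrow> ('a, 'b) pre_digraph \<Rightarrow> nat" where
  "free_chromatic_number \<G> H = (LEAST k. \<exists>\<pi>. free_coloring \<G> H k \<pi>)"

definition free_critical :: "graph_family \<Rightarrow> ('a, 'b) pre_digraph \<Rightarrow> bool" where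
  "free_critical \<G> H \<longleftrightarrow>
     (\<forall>H'. subgraph H' H \<and> graph H' \<and> H' \<noteq> H \<longrightarrow>
        free_chromatic_number \<G> H' < free_chromatic_number \<G> H)"

text \<open>Meaningful for finite graphs with at least one vertex.\<close>
definition min_degree :: "('a, 'b) pre_digraph \<Rightarrow> nat" where
  "min_degree G = Min (out_degree G ` verts G)"

text \<open>For a nonempty family the infimum is attained, as the values are natural numbers.\<close>
definition family_min_degree :: "graph_family \<Rightarrow> nat" where
  "family_min_degree \<G> = (INF G\<in>\<G>. min_degree (with_proj G))"

text \<open>The graph without vertices, which is only vacuously regular, is excluded.\<close>
definition two_regular_graphs :: graph_family where
  "two_regular_graphs =
     {G. pair_graph G \<and> pverts G \<noteq> {} \<and> (\<forall>v \<in> pverts G. out_degree (with_proj G) v = 2)}"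

text \<open>
  Equality of families of graphs, where, as usual, isomorphic graphs are not distinguished.
\<close>
definition same_family :: "graph_family \<Rightarrow> graph_family \<Rightarrow> bool" where
  "same_family \<F> \<G> \<longleftrightarrow>
     (\<forall>F \<in> \<F>. \<exists>G \<in> \<G>. digraph_iso (with_proj F) (with_proj G)) \<and>
     (\<forall>G \<in> \<G>. \<exists>F \<in> \<F>. digraph_iso (with_proj G) (with_proj F))"

definition complement :: "'a pair_pre_digraph \<Rightarrow> 'a pair_pre_digraph" where
  "complement H =
     \<lparr> pverts = pverts H,
       parcs = {(u, v). u \<in> pverts H \<and> v \<in> pverts H \<and> u \<noteq> v \<and> (u, v) \<notin> parcs H} \<rparr>"

lemma pair_graph_complement:
  assumes "pair_graph H"
  shows "pair_graph (complement H)"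
proof -
  interpret pair_graph H by fact
  have "finite (parcs (complement H))"
    by (rule finite_subset[of _ "pverts H \<times> pverts H"]) (auto simp: complement_def)
  then show ?thesis
    using pair_finite_verts
    by unfold_locales
      (auto simp: complement_def symmetric_def intro!: symI dest: arcs_symmetric)
qed

lemma family_min_degree_attained:
  assumes "\<G> \<noteq> {}"
  shows "\<exists>G \<in> \<G>. family_min_degree \<G> = min_degree (with_proj G)"
    and "\<forall>G \<in> \<G>. family_min_degree \<G> \<le> min_degree (with_proj G)"
proof -
  have "Inf ((\<lambda>G. min_degree (with_proj G)) ` \<G>) \<in> (\<lambda>G. min_degree (with_proj G)) ` \<G>"
    using assms by (intro Inf_nat_def1) simp
  then show "\<exists>G \<in> \<G>. family_min_degree \<G> = min_degree (with_proj G)"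
    unfolding family_min_degree_def by blast
  show "\<forall>G \<in> \<G>. family_min_degree \<G> \<le> min_degree (with_proj G)"
    unfolding family_min_degree_def by (auto intro: cINF_lower)
qed

lemma free_coloring_exists:
  assumes "finite (verts H)" and order: "\<And>G. G \<in> \<G> \<Longrightarrow> 2 \<le> card (pverts G)"
  shows "\<exists>\<pi>. free_coloring \<G> H (free_chromatic_number \<G> H) \<pi>"
proof -
  obtain \<pi> where \<pi>: "bij_betw \<pi> (verts H) {1..card (verts H)}"
    using finite_same_card_bij[OF assms(1), of "{1..card (verts H)}"] by auto
  have "\<not> contains_copy (H \<restriction> {v \<in> verts H. \<pi> v = i}) (with_proj G)" if G: "G \<in> \<G>" for i G
  proof
    assume "contains_copy (H \<restriction> {v \<in> verts H. \<pi> v = i}) (with_proj G)"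
    then obtain S f where S: "subgraph S (H \<restriction> {v \<in> verts H. \<pi> v = i})"
      and f: "pre_digraph.digraph_isomorphism (with_proj G) f" "S = app_iso f (with_proj G)"
      unfolding contains_copy_def digraph_iso_def by blast
    have "verts S \<subseteq> {v \<in> verts H. \<pi> v = i}"
      using S by (auto simp: subgraph_def)
    then have *: "u = v" if "u \<in> verts S" "v \<in> verts S" for u v
      using that inj_onD[OF bij_betw_imp_inj_on[OF \<pi>], of u v] by blast
    have "card (pverts G) = card (verts S)"
      using f by (simp add: pre_digraph.digraph_isomorphism_def verts_app_iso card_image)
    moreover have "card (verts S) \<le> 1"
      using * by (cases "finite (verts S)") (simp_all add: card_le_Suc0_iff_eq)
    ultimately show False
      using order[OF G] by simp
  qed
  then have "free_coloring \<G> H (card (verts H)) \<pi>"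
    using bij_betwE[OF \<pi>] unfolding free_coloring_def by blast
  then have "\<exists>\<pi>. free_coloring \<G> H (card (verts H)) \<pi>"
    by blast
  then show ?thesis
    unfolding free_chromatic_number_def by (rule LeastI)
qed

end

theory Submission
  imports Defs
begin

text \<open>
  Put \<open>d = \<delta>(\<G>)\<close>. A vertex set \<open>A\<close> of \<open>H\<close> that is minimal among those that cannot be coloured
  with \<open>\<chi>(H) - 1\<close> colours induces a subgraph of minimum degree at least \<open>d (\<chi>(H) - 1)\<close>: a vertex
  \<open>v\<close> of \<open>A\<close> fits into none of the colour classes of \<open>A - {v}\<close>, so it has at least \<open>d\<close> neighbours
  in each. Let \<open>B\<close> be such a set for the complement, and suppose that
  \<open>d (\<chi>(H) - 1) + d (\<chi>(complement H) - 1) \<ge> n\<close>. Then \<open>|A| + |B| > n\<close>, so \<open>A\<close> and \<open>B\<close> share a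
  vertex, and its degrees in \<open>H\<close> and in the complement add up to at least \<open>n\<close>, whereas they
  add up to \<open>n - 1\<close>. This gives the bound \<open>\<lceil>n/d\<rceil> + 1\<close> in every case.
\<close>

text \<open>The set \<open>A\<close> varies inside a fixed \<open>H\<close>, so minimal uncolourable
  vertex sets can be studied without passing to induced subgraphs and their own chromatic
  numbers.\<close>

definition free_colorable_on :: "graph_family \<Rightarrow> ('a, 'b) pre_digraph \<Rightarrow> 'a set \<Rightarrow> nat \<Rightarrow> bool" where
  "free_colorable_on \<G> H A k \<longleftrightarrow>
     (\<exists>\<pi>. (\<forall>v \<in> A. \<pi> v \<in> {1..k}) \<and>
       (\<forall>i \<in> {1..k}. \<forall>G \<in> \<G>. \<not> contains_copy (H \<restriction> {v \<in> A. \<pi> v = i}) (with_proj G)))"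

lemma free_colorable_on_verts_iff:
  "free_colorable_on \<G> H (verts H) k \<longleftrightarrow> (\<exists>\<pi>. free_coloring \<G> H k \<pi>)"
  by (simp add: free_colorable_on_def free_coloring_def)

lemma not_contains_copy_no_verts:
  assumes "verts H = {}" "verts G \<noteq> {}"
  shows "\<not> contains_copy H G"
proof
  assume "contains_copy H G"
  then obtain S f where "subgraph S H" "S = app_iso f G"
    unfolding contains_copy_def digraph_iso_def by blast
  then have "iso_verts f ` verts G \<subseteq> verts H"
    by (auto simp: subgraph_def verts_app_iso)
  then show False
    using assms by simp
qed

text \<open>A copy avoiding \<open>v\<close> would already lie in \<open>S\<close>, so
  \<open>v\<close> is the image of some vertex \<open>u\<close> of \<open>G\<close>. The neighbours
  of \<open>u\<close> go injectively to neighbours of \<open>v\<close>, and these lie in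
  \<open>S\<close> because there are no loops.\<close>

lemma degree_ge_of_new_copy:
  assumes H: "pair_graph H" and G: "pair_graph G"
    and copy: "contains_copy (with_proj H \<restriction> insert v S) (with_proj G)"
    and no_copy: "\<not> contains_copy (with_proj H \<restriction> S) (with_proj G)"
    and fin: "finite S"
  shows "min_degree (with_proj G) \<le> card {w \<in> S. (v, w) \<in> parcs H}"
proof -
  interpret H: pair_graph H by fact
  interpret G: pair_graph G by fact
  from copy obtain T f where T: "subgraph T (with_proj H \<restriction> insert v S)" "graph T"
    and f: "pre_digraph.digraph_isomorphism (with_proj G) f" "T = app_iso f (with_proj G)"
    unfolding contains_copy_def digraph_iso_def by blast
  interpret T: graph T by fact
  have tail: "tail T = fst" and head: "head T = snd"
    using T(1) by (auto simp: subgraph_def compatible_def)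
  have verts_T: "verts T \<subseteq> insert v S"
    and arcs_T: "arcs T \<subseteq> parcs H"
    using T(1) by (auto simp: subgraph_def)
  have ends: "a \<in> arcs T \<Longrightarrow> fst a \<in> verts T \<and> snd a \<in> verts T \<and> fst a \<noteq> snd a" for a
    using T.tail_in_verts T.head_in_verts T.no_loops by (auto simp: tail head)
  have "v \<in> verts T"
  proof (rule ccontr)
    assume v: "v \<notin> verts T"
    have "subgraph T (with_proj H \<restriction> S)"
      unfolding subgraph_def
    proof (intro conjI)
      show "verts T \<subseteq> verts (with_proj H \<restriction> S)"
        using v verts_T by auto
      show "arcs T \<subseteq> arcs (with_proj H \<restriction> S)"
        using v verts_T arcs_T ends by fastforce
      show "compatible (with_proj H \<restriction> S) T"
        by (simp add: compatible_def tail head)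
      show "wf_digraph (with_proj H \<restriction> S)"
        by unfold_locales auto
      show "wf_digraph T" ..
    qed
    then show False
      using no_copy T(2) f unfolding contains_copy_def digraph_iso_def by blast
  qed
  then obtain u where u: "u \<in> pverts G" "v = iso_verts f u"
    using f(2) by (auto simp: verts_app_iso)
  have "min_degree (with_proj G) \<le> out_degree (with_proj G) u"
    unfolding min_degree_def using u(1) G.pair_finite_verts by (intro Min_le) auto
  also have "\<dots> = out_degree T v"
    using G.out_degree_app_iso_eq[OF f(1), of u] u f(2) by simp
  \<comment> \<open>Arcs of \<open>T\<close> are pairs, so an arc leaving \<open>v\<close> is
    determined by its head: counting arcs becomes counting neighbours.\<close>
  also have "\<dots> = card (snd ` out_arcs T v)"
    unfolding out_degree_def
    by (intro card_image[symmetric] inj_onI) (auto simp: out_arcs_def tail intro: prod_eqI)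
  also have "\<dots> \<le> card {w \<in> S. (v, w) \<in> parcs H}"
  proof (rule card_mono)
    show "snd ` out_arcs T v \<subseteq> {w \<in> S. (v, w) \<in> parcs H}"
      using ends verts_T arcs_T by (fastforce simp: out_arcs_def tail)
  qed (use fin in simp)
  finally show ?thesis .
qed

text \<open>Giving \<open>v\<close> any colour \<open>i\<close> must spoil the colouring of
  \<open>A - {v}\<close>, which forces \<open>family_min_degree \<G>\<close> neighbours of
  \<open>v\<close> into class \<open>i\<close>. The \<open>k\<close> classes are disjoint, so these
  numbers add up.\<close>

lemma degree_ge_of_critical_vertex:
  assumes H: "pair_graph H" and G: "\<And>G. G \<in> \<G> \<Longrightarrow> pair_graph G"
    and ne: "\<G> \<noteq> {}" and fin: "finite A" and v: "v \<in> A"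
    and A: "\<not> free_colorable_on \<G> (with_proj H) A k"
    and A': "free_colorable_on \<G> (with_proj H) (A - {v}) k"
  shows "family_min_degree \<G> * k \<le> card {w \<in> A. (v, w) \<in> parcs H}"
proof -
  obtain \<pi> where \<pi>: "\<forall>w \<in> A - {v}. \<pi> w \<in> {1..k}"
    and free: "\<And>i G. i \<in> {1..k} \<Longrightarrow> G \<in> \<G> \<Longrightarrow>
      \<not> contains_copy (with_proj H \<restriction> {w \<in> A - {v}. \<pi> w = i}) (with_proj G)"
    using A' unfolding free_colorable_on_def by blast
  let ?N = "\<lambda>i. {w \<in> {w \<in> A - {v}. \<pi> w = i}. (v, w) \<in> parcs H}"
  have N: "family_min_degree \<G> \<le> card (?N i)" if i: "i \<in> {1..k}" for i
  proof -
    have "\<forall>w \<in> A. (\<pi>(v := i)) w \<in> {1..k}"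
      using \<pi> i by auto
    then obtain j G where j: "j \<in> {1..k}" and "G \<in> \<G>"
      and copy: "contains_copy (with_proj H \<restriction> {w \<in> A. (\<pi>(v := i)) w = j}) (with_proj G)"
      using A unfolding free_colorable_on_def by blast
    have recolored: "{w \<in> A. (\<pi>(v := i)) w = j} =
        (if j = i then insert v {w \<in> A - {v}. \<pi> w = i} else {w \<in> A - {v}. \<pi> w = j})"
      using v by auto
    \<comment> \<open>Recolouring \<open>v\<close> leaves every class of \<open>A - {v}\<close>
      other than \<open>i\<close> as it was, hence free of copies.\<close>
    have "j = i"
      using copy free[OF j \<open>G \<in> \<G>\<close>] unfolding recolored by (auto split: if_splits)
    then have "contains_copy (with_proj H \<restriction> insert v {w \<in> A - {v}. \<pi> w = i}) (with_proj G)"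
      using copy unfolding recolored by simp
    from degree_ge_of_new_copy[OF H G[OF \<open>G \<in> \<G>\<close>] this free[OF i \<open>G \<in> \<G>\<close>]]
    have "min_degree (with_proj G) \<le> card (?N i)"
      using fin by simp
    then show ?thesis
      using family_min_degree_attained(2)[OF ne] \<open>G \<in> \<G>\<close> by (meson order_trans)
  qed
  have "family_min_degree \<G> * k = (\<Sum>i\<in>{1..k}. family_min_degree \<G>)"
    by simp
  also have "\<dots> \<le> (\<Sum>i\<in>{1..k}. card (?N i))"
    by (intro sum_mono N)
  also have "\<dots> = card (\<Union>i\<in>{1..k}. ?N i)"
    using fin by (intro card_UN_disjoint[symmetric]) auto
  also have "\<dots> \<le> card {w \<in> A. (v, w) \<in> parcs H}"
    using fin by (intro card_mono) auto
  finally show ?thesis .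
qed

lemma ex_subset_min_degree_ge:
  assumes H: "pair_graph H" and G: "\<And>G. G \<in> \<G> \<Longrightarrow> pair_graph G"
    and order: "\<And>G. G \<in> \<G> \<Longrightarrow> 2 \<le> card (pverts G)"
    and ne: "\<G> \<noteq> {}" and k: "k < free_chromatic_number \<G> (with_proj H)"
  obtains A where "A \<subseteq> pverts H" "A \<noteq> {}"
    "\<And>v. v \<in> A \<Longrightarrow> family_min_degree \<G> * k \<le> card {w \<in> A. (v, w) \<in> parcs H}"
proof -
  interpret H: pair_graph H by fact
  let ?P = "\<lambda>A. A \<subseteq> pverts H \<and> \<not> free_colorable_on \<G> (with_proj H) A k"
  have "?P (pverts H)"
    using not_less_Least[OF k[unfolded free_chromatic_number_def]]
      free_colorable_on_verts_iff[of \<G> "with_proj H" k] by simp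
  then obtain A where A: "?P A" and min: "\<And>B. ?P B \<Longrightarrow> card A \<le> card B"
    using ex_has_least_nat[of ?P "pverts H" card] by blast
  have fin: "finite A"
    using A H.pair_finite_verts finite_subset by blast
  \<comment> \<open>This also covers \<open>k = 0\<close>. There the degree bound is trivial, and
    what counts is that \<open>A\<close> is nonempty.\<close>
  have "free_colorable_on \<G> (with_proj H) {} k"
  proof -
    have "pverts G \<noteq> {}" if "G \<in> \<G>" for G
      using order[OF that] by auto
    then show ?thesis
      by (auto simp: free_colorable_on_def not_contains_copy_no_verts)
  qed
  then have "A \<noteq> {}"
    using A by blast
  moreover have "family_min_degree \<G> * k \<le> card {w \<in> A. (v, w) \<in> parcs H}" if v: "v \<in> A" for v
  proof (rule degree_ge_of_critical_vertex[OF H G ne fin v])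
    show "free_colorable_on \<G> (with_proj H) (A - {v}) k"
      using min[of "A - {v}"] A card_Diff1_less[OF fin v] by auto
  qed (use A in auto)
  ultimately show thesis
    using that A by blast
qed

text \<open>With \<open>k = 0\<close> the colour set \<open>{1..k}\<close> is empty, so no vertex
  can be coloured. Positivity makes the natural subtraction in \<open>?k - 1\<close> exact.\<close>

lemma free_chromatic_number_pos:
  assumes "verts H \<noteq> {}" "finite (verts H)" "\<And>G. G \<in> \<G> \<Longrightarrow> 2 \<le> card (pverts G)"
  shows "0 < free_chromatic_number \<G> H"
proof (rule Nat.gr0I)
  assume "free_chromatic_number \<G> H = 0"
  then obtain \<pi> where "free_coloring \<G> H 0 \<pi>"
    using free_coloring_exists[of H \<G>, OF assms(2,3)] by auto
  then show False
    using assms(1) by (simp add: free_coloring_def)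
qed

lemma free_chromatic_number_no_verts:
  assumes "verts H = {}"
  shows "free_chromatic_number \<G> H = 0"
  unfolding free_chromatic_number_def
  by (intro Least_eq_0 exI[of _ undefined]) (simp add: free_coloring_def assms)

text \<open>No colouring enters here, only degrees: the strict inequality comes from a common vertex
  \<open>v\<close> of \<open>A\<close> and \<open>B\<close> that is adjacent to itself in neither
  graph.\<close>

lemma sum_lower_degrees_less:
  assumes H: "pair_graph H"
    and A: "A \<subseteq> pverts H" "A \<noteq> {}" "\<And>v. v \<in> A \<Longrightarrow> a \<le> card {w \<in> A. (v, w) \<in> parcs H}"
    and B: "B \<subseteq> pverts H" "B \<noteq> {}"
      "\<And>v. v \<in> B \<Longrightarrow> b \<le> card {w \<in> B. (v, w) \<in> parcs (complement H)}"
  shows "a + b < card (pverts H)"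
proof (rule ccontr)
  assume contr: "\<not> a + b < card (pverts H)"
  interpret H: pair_graph H by fact
  interpret C: pair_graph "complement H"
    using H by (rule pair_graph_complement)
  note finV = H.pair_finite_verts
  have finA: "finite A" and finB: "finite B"
    using A(1) B(1) finV finite_subset by blast+
  have gt: "c < card S"
    if "finite S" "v \<in> S" "c \<le> card {w \<in> S. (v, w) \<in> parcs K}" "pair_graph K"
    \<comment> \<open>\<open>S\<close> contains \<open>v\<close> besides its neighbours. Leaving
      \<open>K\<close> arbitrary serves both \<open>H\<close> and its complement.\<close>
    for c v and S :: "'a set" and K
  proof -
    interpret K: pair_graph K by fact
    have "{w \<in> S. (v, w) \<in> parcs K} \<subset> S"
      using that(2) by (auto dest: K.no_loops')
    from psubset_card_mono[OF that(1) this] show ?thesis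
      using that(3) by simp
  qed
  have "a < card A" "b < card B"
    using A(2,3) B(2,3) gt[OF finA _ _ H] gt[OF finB _ _ C.pair_graph_axioms] by blast+
  moreover have "card (A \<union> B) \<le> card (pverts H)"
    using A(1) B(1) finV by (intro card_mono) auto
  \<comment> \<open>Disjoint sets would have more than \<open>a + b\<close> vertices together, and
    \<open>a + b\<close> is assumed to be at least the order of \<open>H\<close>.\<close>
  ultimately have "A \<inter> B \<noteq> {}"
    using contr card_Un_disjoint[OF finA finB] by linarith
  then obtain v where v: "v \<in> A" "v \<in> B"
    by blast
  let ?N = "\<lambda>S K. {w \<in> S. (v, w) \<in> parcs K}"
  have "a + b \<le> card (?N A H) + card (?N B (complement H))"
    using A(3) B(3) v by (intro add_mono) auto
  also have "\<dots> = card (?N A H \<union> ?N B (complement H))"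
    using finA finB by (intro card_Un_disjoint[symmetric]) (auto simp: complement_def)
  also have "\<dots> < card (pverts H)"
  proof (rule psubset_card_mono[OF finV])
    have "v \<in> pverts H" "v \<notin> ?N A H \<union> ?N B (complement H)"
      using v A(1) by (auto simp: complement_def dest: H.no_loops')
    then show "?N A H \<union> ?N B (complement H) \<subset> pverts H"
      using A(1) B(1) by blast
  qed
  finally show False
    using contr by simp
qed

theorem theorem2:
  fixes \<G> :: "nat pair_pre_digraph set" and H :: "'a pair_pre_digraph"
  assumes "\<G> \<noteq> {}"
    and "\<And>G. G \<in> \<G> \<Longrightarrow> pair_graph G"
    and "\<And>G. G \<in> \<G> \<Longrightarrow> 2 \<le> card (pverts G)"
    and "1 \<le> family_min_degree \<G>"
    and "pair_graph H"
  shows "int (free_chromatic_number \<G> (with_proj H))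
           + int (free_chromatic_number \<G> (with_proj (complement H)))
         \<le> (if same_family \<G> two_regular_graphs
                \<or> free_critical \<G> (with_proj H)
                \<or> free_critical \<G> (with_proj (complement H))
             then \<lceil>real (card (pverts H)) / real (family_min_degree \<G>)\<rceil> + 1
             else \<lceil>real (card (pverts H)) / real (family_min_degree \<G>)\<rceil> + 2)"
proof -
  let ?H' = "complement H"
  let ?k = "free_chromatic_number \<G> (with_proj H)"
  let ?l = "free_chromatic_number \<G> (with_proj ?H')"
  let ?d = "family_min_degree \<G>"
  let ?n = "card (pverts H)"
  interpret H: pair_graph H by fact
  have H': "pair_graph ?H'" "pverts ?H' = pverts H"
    using pair_graph_complement[OF \<open>pair_graph H\<close>] by (auto simp: complement_def)
  have "int ?k + int ?l \<le> \<lceil>real ?n / real ?d\<rceil> + 1"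
  proof (cases "pverts H = {}")
    \<comment> \<open>Both chromatic numbers are 0 here, so subtracting 1 would truncate; the bound
      reads \<open>0 \<le> 1\<close>.\<close>
    case True
    then show ?thesis
      using H'(2) by (simp add: free_chromatic_number_no_verts)
  next
    case False
    have pos: "0 < ?k" "0 < ?l"
      by (rule free_chromatic_number_pos; use False H'(2) H.pair_finite_verts assms(3) in simp)+
    obtain A where A: "A \<subseteq> pverts H" "A \<noteq> {}"
      "\<And>v. v \<in> A \<Longrightarrow> ?d * (?k - 1) \<le> card {w \<in> A. (v, w) \<in> parcs H}"
      using ex_subset_min_degree_ge[OF assms(5) assms(2,3,1), of "?k - 1"] pos by auto
    obtain B where B: "B \<subseteq> pverts H" "B \<noteq> {}"
      "\<And>v. v \<in> B \<Longrightarrow> ?d * (?l - 1) \<le> card {w \<in> B. (v, w) \<in> parcs ?H'}"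
      using ex_subset_min_degree_ge[OF H'(1) assms(2,3,1), of "?l - 1"] pos H'(2) by auto
    have "?d * (?k - 1) + ?d * (?l - 1) < ?n"
      using sum_lower_degrees_less[OF assms(5) A B] .
    then have "?d * ((?k - 1) + (?l - 1)) < ?n"
      by (simp add: algebra_simps)
    then have "real ?d * real ((?k - 1) + (?l - 1)) < real ?n"
      by (metis of_nat_less_iff of_nat_mult)
    then have "real ((?k - 1) + (?l - 1)) < real ?n / real ?d"
      using assms(4) by (simp add: field_simps)
    \<comment> \<open>An integer strictly below a real is strictly below its ceiling. So
      \<open>?k + ?l - 2\<close> is at most the ceiling minus 1, which yields the summand 1 of the
      bound.\<close>
    then have "int ((?k - 1) + (?l - 1)) < \<lceil>real ?n / real ?d\<rceil>"
      by (simp add: less_ceiling_iff)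
    then show ?thesis
      using pos by linarith
  qed
  then show ?thesis
    by simp
qed

end
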